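(* There is an absolute constant $C>0$ such that the following holds. Let $A$ be a real $m\times n$ matrix with no zero rows and let $b\in\mathbb{R}^m$. Assume that the linear system $Ax=b$ is consistent and that $A$ is reflection consistent. Let $x_0\in\mathbb{R}^n$, define for $k=0,1,2,\ldots$ $$x_{k+1}=x_k+2\,\frac{b_{i_k}-A_{i_k}^{T}x_k}{\|A_{i_k}\|^2}\,A_{i_k},\qquad i_k=(k\bmod m)+1,$$ and let $x_*$ be the solution of $Ax=b$ that has the minimal distance to $x_0$. Then the average of $\{x_k:k=0,1,2,\ldots\}$ converges to $x_*$, i.e. $\lim_{N\to\infty}\frac1N\sum_{k=0}^{N-1}x_k=x_*$. Moreover, for every $\varepsilon\in(0,1]$ there is a positive integer $N\le C\,\eta(A)/\varepsilon$ such that $$\left\|\frac1N\sum_{i=0}^{N-1}x_{im}-x_*\right\|\le\varepsilon\,\|x_0-x_*\|.$$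
   Context: $A_i^{T}$ denotes the $i$-th row of $A$ (so $A_i$ is a column vector), $b_i$ the $i$-th entry of $b$, $\|\cdot\|$ the Euclidean norm. Let $R_i=I_n-2\frac{A_iA_i^{T}}{\|A_i\|^2}$ and $R_A=R_m\cdots R_2R_1$, an orthogonal matrix with eigenvalues $e^{i\theta_1},\ldots,e^{i\theta_n}$, $|\theta_l|\le\pi$. The eigengap inverse is $\eta(A)=1/\min_{l:\theta_l\neq0}|\theta_l|$. Reflection consistency: let $r$ be the rank of $A$ and let $a_1^{T},\ldots,a_r^{T}$ be $r$ linearly independent rows of $A$; $A$ is called reflection consistent if $R_A$ and $\prod_{i=1}^r\big(I_n-2\frac{a_ia_i^{T}}{\|a_i\|^2}\big)$ have the same eigenspace corresponding to the eigenvalue $1$ (this does not depend on the choice of $a_1,\ldots,a_r$). *)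

theory Defs
  imports
    Complex_Main
    "Jordan_Normal_Form.Char_Poly"
    "Jordan_Normal_Form.DL_Rank"
begin

text \<open>
  The constant in the theorem is uniform in the dimensions, so the dimensions have to be quantified
  inside the formula; hence vectors and matrices with explicit carriers.  Row indices start at 0.
\<close>

definition enorm :: "real vec \<Rightarrow> real" where
  "enorm v = sqrt (v \<bullet> v)"

definition reflection :: "nat \<Rightarrow> real vec \<Rightarrow> real mat" where
  "reflection n a =
     1\<^sub>m n - (2 / (enorm a)\<^sup>2) \<cdot>\<^sub>m mat n n (\<lambda>(i, j). a $ i * a $ j)"

text \<open>The reflection of the head of the list is the rightmost factor, i.e.\ it acts first.\<close>

definition reflection_prod :: "nat \<Rightarrow> real vec list \<Rightarrow> real mat" where
  "reflection_prod n as = fold (\<lambda>a P. reflection n a * P) as (1\<^sub>m n)"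

definition refl_mat :: "real mat \<Rightarrow> real mat" where
  "refl_mat A = reflection_prod (dim_col A) (rows A)"

text \<open>
  The angles are taken in the closed interval from \<open>-pi\<close> to \<open>pi\<close>; an eigenvalue \<open>-1\<close> contributes
  both end points, which have the same absolute value.  The minimum is over a finite set, which is
  empty (and the value then irrelevant) only if the product of the reflections is the identity.
\<close>

definition eigengap_inv :: "real mat \<Rightarrow> real" where
  "eigengap_inv A =
     1 / Min {\<bar>\<theta>\<bar> | \<theta>. \<bar>\<theta>\<bar> \<le> pi \<and> \<theta> \<noteq> 0 \<and>
                eigenvalue (map_mat complex_of_real (refl_mat A)) (cis \<theta>)}"

definition eigenspace :: "real mat \<Rightarrow> real \<Rightarrow> real vec set" where
  "eigenspace M c = {v \<in> carrier_vec (dim_row M). M *\<^sub>v v = c \<cdot>\<^sub>v v}"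

definition indep_vecs :: "nat \<Rightarrow> real vec list \<Rightarrow> bool" where
  "indep_vecs n as \<longleftrightarrow> set as \<subseteq> carrier_vec n \<and> distinct as \<and>
     \<not> module.lin_dep class_ring (module_vec TYPE(real) n) (set as)"

text \<open>
  The condition does not depend on the choice (or order) of the independent rows, so it is only
  required for some choice.  The locale argument of the rank is the length of the columns.
\<close>

definition reflection_consistent :: "real mat \<Rightarrow> bool" where
  "reflection_consistent A \<longleftrightarrow>
     (\<exists>as. set as \<subseteq> set (rows A) \<and> length as = vec_space.rank (dim_row A) A \<and>
           indep_vecs (dim_col A) as \<and>
           eigenspace (refl_mat A) 1 = eigenspace (reflection_prod (dim_col A) as) 1)"

primrec refl_iter :: "real mat \<Rightarrow> real vec \<Rightarrow> real vec \<Rightarrow> nat \<Rightarrow> real vec" where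
  "refl_iter A b x0 0 = x0"
| "refl_iter A b x0 (Suc k) =
     (let i = k mod dim_row A; x = refl_iter A b x0 k
      in x + (2 * ((b $ i - row A i \<bullet> x) / (enorm (row A i))\<^sup>2)) \<cdot>\<^sub>v row A i)"

definition average :: "nat \<Rightarrow> (nat \<Rightarrow> real vec) \<Rightarrow> nat \<Rightarrow> real vec" where
  "average n x N = (1 / real N) \<cdot>\<^sub>v finsum_vec TYPE(real) n x {..<N}"

end

theory Submission
  imports Defs "HOL-Analysis.L2_Norm" "Jordan_Normal_Form.Spectral_Radius"
begin

text \<open>
  The errors \<open>y\<^sub>k = x\<^sub>k - x\<^sub>*\<close> are transformed by the reflections, so \<open>y\<^bsub>im\<^esub> = R\<^sup>i y\<^sub>0\<close> with
  \<open>R = R\<^sub>A\<close>.  The fixed space of a product of reflections in independent vectors is the orthogonal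
  complement of these vectors, so reflection consistency says that the fixed space of \<open>R\<close> is the
  kernel of \<open>A\<close>, and by minimality of \<open>x\<^sub>*\<close> the vector \<open>y\<^sub>0\<close> lies in its orthogonal complement
  \<open>W\<close>.  On \<open>W\<close> the displacement satisfies \<open>\<parallel>x\<parallel> \<le> 3 \<eta>(A) \<parallel>x - R x\<parallel>\<close>: the minimum of
  \<open>\<parallel>x - R x\<parallel>\<^sup>2\<close> on the unit sphere of \<open>W\<close> is \<open>2 - 2 cos t\<close> for an eigenvalue \<open>cis t\<close> of \<open>R\<close>.
  The partial sum \<open>s\<close> of the first \<open>N\<close> vectors \<open>R\<^sup>i y\<^sub>0\<close> lies in \<open>W\<close>, and
  \<open>s - R s = y\<^sub>0 - R\<^sup>N y\<^sub>0\<close> telescopes, whence \<open>\<parallel>s\<parallel> \<le> 6 \<eta>(A) \<parallel>y\<^sub>0\<parallel>\<close> independently of \<open>N\<close>.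
\<close>

subsection \<open>The Euclidean norm\<close>

lemma scalar_prod_self_nonneg: "(v :: real vec) \<bullet> v \<ge> 0"
  by (simp add: scalar_prod_def sum_nonneg)

lemma scalar_prod_self_eq_0_iff:
  "v \<in> carrier_vec n \<Longrightarrow> (v :: real vec) \<bullet> v = 0 \<longleftrightarrow> v = 0\<^sub>v n"
  by (auto simp: scalar_prod_def sum_nonneg_eq_0_iff intro!: eq_vecI)

lemma enorm_nonneg [simp]: "enorm v \<ge> 0"
  by (simp add: enorm_def scalar_prod_self_nonneg)

lemma enorm_sq: "(enorm v)\<^sup>2 = v \<bullet> v"
  by (simp add: enorm_def scalar_prod_self_nonneg)

lemma enorm_zero [simp]: "enorm (0\<^sub>v n) = 0"
  by (simp add: enorm_def)

lemma enorm_eq_0_iff: "v \<in> carrier_vec n \<Longrightarrow> enorm v = 0 \<longleftrightarrow> v = 0\<^sub>v n"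
  by (metis enorm_sq scalar_prod_self_eq_0_iff zero_eq_power2)

lemma enorm_L2_set: "v \<in> carrier_vec n \<Longrightarrow> enorm v = L2_set (($) v) {..<n}"
  by (simp add: enorm_def L2_set_def scalar_prod_def lessThan_atLeast0 power2_eq_square)

lemma enorm_triangle:
  assumes "v \<in> carrier_vec n" "w \<in> carrier_vec n"
  shows "enorm (v + w) \<le> enorm v + enorm w"
proof -
  have "L2_set (($) (v + w)) {..<n} = L2_set (\<lambda>i. v $ i + w $ i) {..<n}"
    using assms by (intro L2_set_cong) auto
  then show ?thesis
    using assms by (simp add: enorm_L2_set[of _ n] L2_set_triangle_ineq)
qed

lemma enorm_smult: "v \<in> carrier_vec n \<Longrightarrow> enorm (c \<cdot>\<^sub>v v) = \<bar>c\<bar> * enorm v"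
  by (simp add: enorm_def real_sqrt_mult flip: mult.assoc power2_eq_square)

lemma enorm_minus:
  assumes "v \<in> carrier_vec n" "w \<in> carrier_vec n"
  shows "enorm (v - w) \<le> enorm v + enorm w"
proof -
  have "v - w = v + (-1) \<cdot>\<^sub>v w" using assms by (intro eq_vecI) auto
  moreover have "enorm ((-1) \<cdot>\<^sub>v w) = enorm w" using enorm_smult[OF assms(2), of "-1"] by simp
  ultimately show ?thesis
    using enorm_triangle[of v n "(-1) \<cdot>\<^sub>v w"] assms by (metis smult_carrier_vec)
qed

subsection \<open>Independent rows and the kernel\<close>

text \<open>Combinations in coordinates, with coefficients indexed by the vectors themselves; this
  allows work outside the locale \<open>vec_space\<close>, which fixes the dimension.\<close>

definition vcomb :: "nat \<Rightarrow> (real vec \<Rightarrow> real) \<Rightarrow> real vec set \<Rightarrow> real vec" where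
  "vcomb n c S = vec n (\<lambda>j. \<Sum>s\<in>S. c s * s $ j)"

lemma vcomb_carrier [simp]: "vcomb n c S \<in> carrier_vec n"
  by (simp add: vcomb_def)

lemma dim_vcomb [simp]: "dim_vec (vcomb n c S) = n"
  by (simp add: vcomb_def)

lemma vcomb_empty [simp]: "vcomb n c {} = 0\<^sub>v n"
  by (auto simp: vcomb_def)

lemma vcomb_insert:
  assumes "finite S" "s \<notin> S" "s \<in> carrier_vec n"
  shows "vcomb n c (insert s S) = c s \<cdot>\<^sub>v s + vcomb n c S"
  using assms by (auto simp: vcomb_def)

lemma scalar_prod_vcomb:
  assumes "finite S" "S \<subseteq> carrier_vec n" "x \<in> carrier_vec n"
  shows "x \<bullet> vcomb n c S = (\<Sum>s\<in>S. c s * (x \<bullet> s))"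
  using assms
proof (induction S rule: finite_induct)
  case (insert s S)
  then show ?case
    by (simp add: vcomb_insert scalar_prod_add_distrib[of _ n])
qed simp

lemma indep_vecs_vcomb_0:
  assumes "indep_vecs n as" "vcomb n c (set as) = 0\<^sub>v n" "v \<in> set as"
  shows "c v = 0"
proof (rule ccontr)
  assume *: "c v \<noteq> 0"
  interpret vec_space "TYPE(real)" n .
  have as: "set as \<subseteq> carrier_vec n" using assms by (simp add: indep_vecs_def)
  have "lincomb c (set as) = vcomb n c (set as)"
    using as by (intro eq_vecI) (auto simp: lincomb_index vcomb_def lincomb_dim)
  then have "lin_dep (set as)"
    using lin_dep_crit[where A = "set as" and S = "set as" and a = c and v = v] assms(2,3) * by (auto simp: class_ring_simps)
  then show False using assms(1) by (simp add: indep_vecs_def)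
qed

text \<open>By hypothesis \<open>A\<close> kills only the trivial combination of \<open>S\<close>,
  so the images of \<open>S\<close> are distinct and independent vectors of the column space, whose
  dimension is the rank.\<close>

lemma card_le_rank:
  fixes A :: "real mat"
  assumes A: "A \<in> carrier_mat m n" and S: "finite S" "S \<subseteq> carrier_vec n"
    and indep: "\<And>c. A *\<^sub>v vcomb n c S = 0\<^sub>v m \<Longrightarrow> \<forall>s\<in>S. c s = 0"
  shows "card S \<le> vec_space.rank m A"
proof -
  interpret W: vec_space "TYPE(real)" m .
  have comb: "(A *\<^sub>v vcomb n c S) $ i = (\<Sum>s\<in>S. c s * (A *\<^sub>v s) $ i)" if "i < m" for c i
    using that A S scalar_prod_vcomb[OF S, of "row A i" c] by auto
  have inj: "inj_on ((*\<^sub>v) A) S"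
  proof (rule inj_onI, rule ccontr)
    fix s t assume st: "s \<in> S" "t \<in> S" "A *\<^sub>v s = A *\<^sub>v t" "s \<noteq> t"
    \<comment> \<open>The combination \<open>s - t\<close>, which \<open>A\<close> would send to
      zero.\<close>
    define c where "c = (\<lambda>x. (if x = s then 1 else 0) - (if x = t then 1 else 0 :: real))"
    have "(\<Sum>x\<in>S. c x * (A *\<^sub>v x) $ i) = 0" for i
      using st S by (simp add: c_def left_diff_distrib sum_subtractf if_distrib[of "\<lambda>x. x * _"] sum.delta cong: if_cong)
    then have "A *\<^sub>v vcomb n c S = 0\<^sub>v m"
      using A comb by (intro eq_vecI) (simp_all del: index_mult_mat_vec)
    then show False using indep[of c] st by (auto simp: c_def)
  qed
  let ?B = "((*\<^sub>v) A) ` S"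
  have B: "?B \<subseteq> carrier_vec m" "finite ?B" using A S by auto
  have "W.lin_indpt ?B"
  proof (rule W.finite_lin_indpt2)
    fix a assume *: "W.lincomb a ?B = 0\<^sub>v m"
    have "A *\<^sub>v vcomb n (\<lambda>s. a (A *\<^sub>v s)) S = 0\<^sub>v m"
    proof (rule eq_vecI)
      fix i assume i: "i < dim_vec (0\<^sub>v m)"
      then have i: "i < m" by simp
      have "0 = W.lincomb a ?B $ i" using * i by simp
      also have "\<dots> = (\<Sum>s\<in>S. a (A *\<^sub>v s) * (A *\<^sub>v s) $ i)"
        using W.lincomb_index[OF i B(1)] by (simp add: sum.reindex[OF inj])
      finally show "(A *\<^sub>v vcomb n (\<lambda>s. a (A *\<^sub>v s)) S) $ i = 0\<^sub>v m $ i" using comb[OF i] i by simp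
    qed (use A in simp)
    from indep[OF this] show "\<forall>v\<in>?B. a v = 0" by simp
  qed (use B in auto)
  have cols: "set (cols A) \<subseteq> carrier_vec m" using A cols_dim by blast
  let ?C = "W.span (set (cols A))"
  have sub: "submodule class_ring ?C (module_vec TYPE(real) m)" using cols W.span_is_submodule by simp
  have "?B \<subseteq> ?C"
    using W.col_space_eq[OF A] A S by (auto simp: W.col_space_def)
  moreover have "vectorspace class_ring (W.vs ?C)"
    using W.span_is_subspace[of "set (cols A)"] cols by (simp add: subspace_def W.subspace_is_vs)
  ultimately have "card ?B \<le> vectorspace.dim class_ring (W.vs ?C)"
    using vectorspace.li_le_dim(2)[OF _ W.fin_dim_span_cols[OF A], of ?B]
      W.span_li_not_depend(2)[OF _ sub, of ?B] \<open>W.lin_indpt ?B\<close> by simp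
  then show ?thesis using card_image[OF inj] by (simp add: W.rank_def)
qed

text \<open>If \<open>A u\<close> were nonzero, then \<open>u\<close> together with the vectors of \<open>as\<close> would be mapped by
  \<open>A\<close> to independent vectors of the column space, one more than its dimension.\<close>

lemma kernel_eq_orthogonal_indep_rows:
  fixes A :: "real mat"
  assumes A: "A \<in> carrier_mat m n" and rows: "set as \<subseteq> set (rows A)"
    and ind: "indep_vecs n as" and len: "length as = vec_space.rank m A"
    and u: "u \<in> carrier_vec n" and orth: "\<And>a. a \<in> set as \<Longrightarrow> a \<bullet> u = 0"
  shows "A *\<^sub>v u = 0\<^sub>v m"
proof (rule ccontr)
  assume Au: "A *\<^sub>v u \<noteq> 0\<^sub>v m"
  have as: "set as \<subseteq> carrier_vec n" "distinct as" using ind by (auto simp: indep_vecs_def)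
  \<comment> \<open>Otherwise \<open>u\<close> would be orthogonal to itself, hence zero,
    contradicting \<open>Au\<close>.\<close>
  have u_notin: "u \<notin> set as"
    using orth[of u] u Au A scalar_prod_self_eq_0_iff[OF u] by auto
  have "card (insert u (set as)) \<le> vec_space.rank m A"
  proof (rule card_le_rank[OF A])
    fix c assume *: "A *\<^sub>v vcomb n c (insert u (set as)) = 0\<^sub>v m"
    define w where "w = vcomb n c (set as)"
    have w: "w \<in> carrier_vec n" by (simp add: w_def)
    have eq: "vcomb n c (insert u (set as)) = c u \<cdot>\<^sub>v u + w"
      using u u_notin by (simp add: vcomb_insert w_def)
    have zero: "row A i \<bullet> (c u \<cdot>\<^sub>v u + w) = 0" if "i < m" for i
      using arg_cong[OF *, of "\<lambda>v. v $ i"] that A by (simp add: eq)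
    \<comment> \<open>The rows in \<open>as\<close> annihilate \<open>u\<close>, so
      \<open>zero\<close> leaves only \<open>w\<close>. As a combination of these rows,
      \<open>w\<close> is then orthogonal to itself.\<close>
    have "a \<bullet> w = 0" if a: "a \<in> set as" for a
    proof -
      obtain i where "i < m" "a = row A i" using rows a A by (auto simp: rows_def)
      moreover have "a \<in> carrier_vec n" using as a by auto
      ultimately show ?thesis using zero[of i] orth[OF a] u w
        by (simp add: scalar_prod_add_distrib[of _ n])
    qed
    then have "w \<bullet> a = 0" if "a \<in> set as" for a
      using comm_scalar_prod[OF w, of a] as that by auto
    then have "w \<bullet> w = 0"
      using scalar_prod_vcomb[of "set as" n w c] as w by (simp flip: w_def)
    then have w0: "w = 0\<^sub>v n" using scalar_prod_self_eq_0_iff[OF w] by simp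
    then have c: "\<forall>a\<in>set as. c a = 0" using indep_vecs_vcomb_0[OF ind] by (simp add: w_def)
    have "c u \<cdot>\<^sub>v (A *\<^sub>v u) = 0\<^sub>v m" using * u by (simp add: eq w0 mult_mat_vec[OF A])
    then have "c u = 0"
      using Au A u by (metis carrier_vecD dim_mult_mat_vec carrier_matD(1) index_smult_vec(1)
        eq_vecI index_zero_vec mult_eq_0_iff)
    then show "\<forall>s\<in>insert u (set as). c s = 0" using c by simp
  qed (use as u in auto)
  then show False using len u_notin distinct_card[OF as(2)] by simp
qed

subsection \<open>Products of reflections\<close>

lemma reflection_carrier [simp]: "a \<in> carrier_vec n \<Longrightarrow> reflection n a \<in> carrier_mat n n"
  by (simp add: reflection_def minus_carrier_mat)

lemma reflection_mult_vec:
  assumes a: "a \<in> carrier_vec n" and x: "x \<in> carrier_vec n"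
  shows "reflection n a *\<^sub>v x = x - (2 * (a \<bullet> x) / (enorm a)\<^sup>2) \<cdot>\<^sub>v a"
proof (rule eq_vecI)
  fix i assume "i < dim_vec (x - (2 * (a \<bullet> x) / (enorm a)\<^sup>2) \<cdot>\<^sub>v a)"
  then have i: "i < n" using a by simp
  let ?c = "2 / (enorm a)\<^sup>2"
  have "(reflection n a *\<^sub>v x) $ i = (\<Sum>j = 0..<n. ((if i = j then 1 else 0) - ?c * (a $ i * a $ j)) * x $ j)"
    using i x by (simp add: reflection_def scalar_prod_def)
  also have "\<dots> = (\<Sum>j = 0..<n. (if i = j then x $ j else 0) - ?c * a $ i * (a $ j * x $ j))"
    by (intro sum.cong) (auto simp: algebra_simps)
  also have "\<dots> = x $ i - ?c * a $ i * (\<Sum>j = 0..<n. a $ j * x $ j)"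
    using i by (simp add: sum_subtractf sum_distrib_left)
  also have "\<dots> = (x - (2 * (a \<bullet> x) / (enorm a)\<^sup>2) \<cdot>\<^sub>v a) $ i"
    using i x a by (simp add: scalar_prod_def)
  finally show "(reflection n a *\<^sub>v x) $ i = (x - (2 * (a \<bullet> x) / (enorm a)\<^sup>2) \<cdot>\<^sub>v a) $ i" .
qed (use a in \<open>simp add: reflection_def\<close>)

lemma enorm_reflection:
  assumes a: "a \<in> carrier_vec n" and x: "x \<in> carrier_vec n"
  shows "enorm (reflection n a *\<^sub>v x) = enorm x"
proof -
  define c where "c = 2 * (a \<bullet> x) / (enorm a)\<^sup>2"
  \<comment> \<open>This includes \<open>a = 0\<close>, where division by zero gives
    \<open>c = 0\<close>.\<close>
  have "c * (c * (a \<bullet> a)) = c * (2 * (a \<bullet> x))"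
    using scalar_prod_self_eq_0_iff[OF a] x by (auto simp: c_def enorm_sq)
  then have "(x - c \<cdot>\<^sub>v a) \<bullet> (x - c \<cdot>\<^sub>v a) = x \<bullet> x"
    using a x comm_scalar_prod[OF a x]
    by (simp add: minus_scalar_prod_distrib[of _ n] scalar_prod_minus_distrib[of _ n] algebra_simps)
  then show ?thesis
    unfolding reflection_mult_vec[OF a x] c_def[symmetric] by (simp add: enorm_def)
qed

lemma reflection_mult_orthogonal:
  assumes "a \<in> carrier_vec n" "x \<in> carrier_vec n" "a \<bullet> x = 0"
  shows "reflection n a *\<^sub>v x = x"
  using assms by (simp add: reflection_mult_vec) (intro eq_vecI; simp)

lemma reflection_prod_Nil [simp]: "reflection_prod n [] = 1\<^sub>m n"
  by (simp add: reflection_prod_def)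

lemma reflection_prod_snoc [simp]:
  "reflection_prod n (as @ [a]) = reflection n a * reflection_prod n as"
  by (simp add: reflection_prod_def)

lemma reflection_prod_carrier [simp]:
  "set as \<subseteq> carrier_vec n \<Longrightarrow> reflection_prod n as \<in> carrier_mat n n"
  by (induction as rule: rev_induct) (auto intro: mult_carrier_mat[of _ n n])

lemma enorm_reflection_prod:
  assumes "set as \<subseteq> carrier_vec n" "x \<in> carrier_vec n"
  shows "enorm (reflection_prod n as *\<^sub>v x) = enorm x"
  using assms
proof (induction as rule: rev_induct)
  case (snoc a as)
  then have "reflection_prod n (as @ [a]) *\<^sub>v x = reflection n a *\<^sub>v (reflection_prod n as *\<^sub>v x)"
    by (simp add: assoc_mult_mat_vec[of _ n n _ n])
  then show ?case
    using snoc enorm_reflection[of a n "reflection_prod n as *\<^sub>v x"]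
      mult_mat_vec_carrier[of "reflection_prod n as" n n x] by simp
qed simp

lemma reflection_prod_mult_orthogonal:
  assumes "set as \<subseteq> carrier_vec n" "x \<in> carrier_vec n" "\<And>a. a \<in> set as \<Longrightarrow> a \<bullet> x = 0"
  shows "reflection_prod n as *\<^sub>v x = x"
  using assms
proof (induction as rule: rev_induct)
  case (snoc a as)
  then show ?case
    by (simp add: assoc_mult_mat_vec[of _ n n _ n] reflection_mult_orthogonal)
qed simp

text \<open>The displacement \<open>x - R x\<close> is a combination of the vectors of \<open>as\<close>; if it vanishes, then
  by independence so do all its coefficients.  The first of them is a multiple of \<open>a\<^sub>1 \<bullet> x\<close>, and
  once this is zero the second one is a multiple of \<open>a\<^sub>2 \<bullet> x\<close>, and so on.\<close>

lemma reflection_prod_displacement: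
  assumes "set as \<subseteq> carrier_vec n" "distinct as" "0\<^sub>v n \<notin> set as" "x \<in> carrier_vec n"
  shows "\<exists>c. reflection_prod n as *\<^sub>v x = x - vcomb n c (set as) \<and>
    ((\<forall>a\<in>set as. c a = 0) \<longrightarrow> (\<forall>a\<in>set as. a \<bullet> x = 0))"
  using assms
proof (induction as rule: rev_induct)
  case (snoc a as)
  then obtain c where c: "reflection_prod n as *\<^sub>v x = x - vcomb n c (set as)"
    "(\<forall>a\<in>set as. c a = 0) \<longrightarrow> (\<forall>a\<in>set as. a \<bullet> x = 0)" by auto
  have a: "a \<in> carrier_vec n" "a \<notin> set as" "a \<noteq> 0\<^sub>v n" using snoc by auto
  define y where "y = reflection_prod n as *\<^sub>v x"
  have y: "y \<in> carrier_vec n" using snoc by (auto simp: y_def)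
  define t where "t = 2 * (a \<bullet> y) / (enorm a)\<^sup>2"
  define c' where "c' = c(a := t)"
  have c'_as: "vcomb n c' (set as) = vcomb n c (set as)"
    unfolding vcomb_def using a(2) by (intro arg_cong[where f = "vec n"] ext sum.cong) (auto simp: c'_def)
  have "reflection_prod n (as @ [a]) *\<^sub>v x = reflection n a *\<^sub>v y"
    using snoc a by (simp add: y_def assoc_mult_mat_vec[of _ n n _ n])
  also have "\<dots> = x - vcomb n c (set as) - t \<cdot>\<^sub>v a"
    using reflection_mult_vec[OF a(1) y] c(1) by (simp add: t_def y_def)
  also have "\<dots> = x - vcomb n c' (set (as @ [a]))"
    using vcomb_insert[of "set as" a n c'] a snoc.prems(4)
    by (intro eq_vecI) (auto simp: c'_as, simp add: c'_def)
  finally have "reflection_prod n (as @ [a]) *\<^sub>v x = x - vcomb n c' (set (as @ [a]))" .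
  moreover have "\<forall>b\<in>set (as @ [a]). b \<bullet> x = 0" if z: "\<forall>b\<in>set (as @ [a]). c' b = 0"
  proof -
    have c0: "\<forall>b\<in>set as. c b = 0" and t: "t = 0"
      using z a(2) by (auto simp: c'_def split: if_splits)
    have "y = x"
      using reflection_prod_mult_orthogonal[of as n x] c(2) c0 snoc.prems by (simp add: y_def)
    moreover have "enorm a \<noteq> 0" using a enorm_eq_0_iff by blast
    ultimately have "a \<bullet> x = 0" using t by (simp add: t_def)
    then show ?thesis using c(2) c0 by simp
  qed
  ultimately show ?case by blast
qed simp

lemma fixed_reflection_prod_indep:
  assumes ind: "indep_vecs n as" and "0\<^sub>v n \<notin> set as" and x: "x \<in> carrier_vec n"
    and fixed: "reflection_prod n as *\<^sub>v x = x" and "a \<in> set as"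
  shows "a \<bullet> x = 0"
proof -
  have as: "set as \<subseteq> carrier_vec n" "distinct as" using ind by (auto simp: indep_vecs_def)
  obtain c where c: "reflection_prod n as *\<^sub>v x = x - vcomb n c (set as)"
    "(\<forall>a\<in>set as. c a = 0) \<longrightarrow> (\<forall>a\<in>set as. a \<bullet> x = 0)"
    using reflection_prod_displacement[OF as assms(2) x] by blast
  have "vcomb n c (set as) $ i = 0" if "i < n" for i
    using arg_cong[OF c(1), of "\<lambda>v. v $ i"] fixed that x by (simp add: vcomb_def)
  then have "vcomb n c (set as) = 0\<^sub>v n"
    by (intro eq_vecI) (auto simp: vcomb_def)
  then show ?thesis using indep_vecs_vcomb_0[OF ind] c(2) assms(5) by blast
qed

lemma refl_mat_carrier [simp]: "A \<in> carrier_mat m n \<Longrightarrow> refl_mat A \<in> carrier_mat n n"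
  using reflection_prod_carrier[of "rows A" n] rows_carrier[of A] by (simp add: refl_mat_def)

lemma set_rows_eq: "set (rows A) = row A ` {..<dim_row A}"
  by (auto simp: rows_def)

text \<open>Reflection consistency enters here: it carries a fixed vector of the full product over
  to the product for \<open>as\<close>, where being fixed means orthogonality to these rows. They
  determine the kernel because their number is the rank.\<close>

lemma fixed_refl_mat_iff:
  assumes A: "A \<in> carrier_mat m n" and nz: "\<And>i. i < m \<Longrightarrow> row A i \<noteq> 0\<^sub>v n"
    and rc: "reflection_consistent A" and x: "x \<in> carrier_vec n"
  shows "refl_mat A *\<^sub>v x = x \<longleftrightarrow> A *\<^sub>v x = 0\<^sub>v m"
proof
  obtain as where as: "set as \<subseteq> set (rows A)" "length as = vec_space.rank m A" "indep_vecs n as"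
    "eigenspace (refl_mat A) 1 = eigenspace (reflection_prod n as) 1"
    using rc A by (auto simp: reflection_consistent_def)
  have asc: "set as \<subseteq> carrier_vec n" using as(3) by (simp add: indep_vecs_def)
  assume "refl_mat A *\<^sub>v x = x"
  then have "x \<in> eigenspace (refl_mat A) 1"
    using x carrier_matD[OF refl_mat_carrier[OF A]] by (simp add: eigenspace_def)
  then have "reflection_prod n as *\<^sub>v x = x"
    using x unfolding as(4) by (auto simp: eigenspace_def)
  moreover have "0\<^sub>v n \<notin> set as"
    using as(1) nz A by (fastforce simp: rows_def)
  ultimately show "A *\<^sub>v x = 0\<^sub>v m"
    using kernel_eq_orthogonal_indep_rows[OF A as(1,3,2) x] fixed_reflection_prod_indep[OF as(3) _ x]
    by blast
next
  assume Ax: "A *\<^sub>v x = 0\<^sub>v m"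
  have "a \<bullet> x = 0" if a: "a \<in> set (rows A)" for a
  proof -
    obtain i where "i < m" "a = row A i" using a A by (auto simp: set_rows_eq)
    then show ?thesis using A arg_cong[OF Ax, of "\<lambda>v. v $ i"] by simp
  qed
  then show "refl_mat A *\<^sub>v x = x"
    using reflection_prod_mult_orthogonal[of "rows A" n x] x A rows_carrier[of A]
    by (simp add: refl_mat_def)
qed

subsection \<open>The displacement of an isometry\<close>

text \<open>A further subsequence makes the next coordinate monotone, hence convergent by
  boundedness, and the earlier coordinates stay convergent along it.\<close>

lemma bounded_coordinates_subseq:
  fixes g :: "nat \<Rightarrow> nat \<Rightarrow> real"
  assumes "\<And>k i. i < n \<Longrightarrow> \<bar>g k i\<bar> \<le> B"
  shows "\<exists>r. strict_mono r \<and> (\<forall>i<n. convergent (\<lambda>k. g (r k) i))"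
  using assms
proof (induction n)
  case 0
  show ?case by (rule exI[of _ id]) (auto simp: strict_mono_def)
next
  case (Suc n)
  then obtain r where r: "strict_mono r" "\<forall>i<n. convergent (\<lambda>k. g (r k) i)"
    using less_Suc_eq by blast
  obtain s where s: "strict_mono s" "monoseq (\<lambda>k. g (r (s k)) n)"
    using seq_monosub[of "\<lambda>k. g (r k) n"] by blast
  have "Bseq (\<lambda>k. g (r (s k)) n)"
    using Suc.prems[of n] by (intro BseqI'[of _ B]) simp
  then have "convergent (\<lambda>k. g (r (s k)) n)"
    using s(2) Bseq_monoseq_convergent by blast
  moreover have "convergent (\<lambda>k. g (r (s k)) i)" if "i < n" for i
    using convergent_subseq_convergent[of "\<lambda>k. g (r k) i" s] r(2) s(1) that by (simp add: o_def)
  ultimately have "\<forall>i<Suc n. convergent (\<lambda>k. g ((r \<circ> s) k) i)"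
    by (auto simp: less_Suc_eq)
  then show ?case using strict_mono_o[OF r(1) s(1)] by blast
qed

lemma tendsto_scalar_prod:
  fixes x y :: "nat \<Rightarrow> real vec"
  assumes "\<And>k. y k \<in> carrier_vec n" "w \<in> carrier_vec n"
    and "\<And>i. i < n \<Longrightarrow> (\<lambda>k. x k $ i) \<longlonglongrightarrow> v $ i" "\<And>i. i < n \<Longrightarrow> (\<lambda>k. y k $ i) \<longlonglongrightarrow> w $ i"
  shows "(\<lambda>k. x k \<bullet> y k) \<longlonglongrightarrow> v \<bullet> w"
proof -
  have "dim_vec (y k) = n" for k using assms(1) by (simp add: carrier_vecD)
  then show ?thesis
    using assms(2-) unfolding scalar_prod_def by (auto intro!: tendsto_sum tendsto_mult)
qed

text \<open>Compactness of the unit sphere of an orthogonal complement, by Bolzano--Weierstrass in each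
  coordinate.\<close>

lemma displacement_attains_min:
  fixes R :: "real mat"
  assumes R: "R \<in> carrier_mat n n" and F: "F \<subseteq> carrier_vec n"
    and W: "W = {x \<in> carrier_vec n. \<forall>u\<in>F. u \<bullet> x = 0}"
    and ex: "x0 \<in> W" "x0 \<bullet> x0 = 1"
  shows "\<exists>v\<in>W. v \<bullet> v = 1 \<and>
    (\<forall>x\<in>W. x \<bullet> x = 1 \<longrightarrow> (v - R *\<^sub>v v) \<bullet> (v - R *\<^sub>v v) \<le> (x - R *\<^sub>v x) \<bullet> (x - R *\<^sub>v x))"
proof -
  define q where "q x = (x - R *\<^sub>v x) \<bullet> (x - R *\<^sub>v x)" for x
  define Q where "Q = q ` {x \<in> W. x \<bullet> x = 1}"
  have Q: "Q \<noteq> {}" "bdd_below Q"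
    using ex by (auto simp: Q_def q_def intro!: bdd_belowI[of _ 0] scalar_prod_self_nonneg)
  \<comment> \<open>A minimising sequence on the unit sphere of \<open>W\<close>.\<close>
  have "\<exists>x. x \<in> W \<and> x \<bullet> x = 1 \<and> q x < Inf Q + inverse (real (Suc k))" for k
  proof -
    have "Inf Q < Inf Q + inverse (real (Suc k))" by simp
    then obtain y where "y \<in> Q" "y < Inf Q + inverse (real (Suc k))"
      using cInf_less_iff[OF Q] by blast
    then show ?thesis by (auto simp: Q_def)
  qed
  then obtain x where x: "\<And>k. x k \<in> W" "\<And>k. x k \<bullet> x k = 1"
    "\<And>k. q (x k) < Inf Q + inverse (real (Suc k))" by metis
  have xc: "x k \<in> carrier_vec n" for k using x(1) W by auto
  have "\<bar>x k $ i\<bar> \<le> 1" if "i < n" for k i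
  proof -
    have "(x k $ i)\<^sup>2 \<le> (\<Sum>j = 0..<n. x k $ j * x k $ j)"
      using that member_le_sum[of i "{0..<n}" "\<lambda>j. x k $ j * x k $ j"] by (simp add: power2_eq_square)
    also have "\<dots> = 1" using x(2)[of k] xc[of k] by (simp add: scalar_prod_def)
    finally show ?thesis by (simp add: abs_square_le_1)
  qed
  then obtain r where r: "strict_mono r" "\<forall>i<n. convergent (\<lambda>k. x (r k) $ i)"
    using bounded_coordinates_subseq[of n "\<lambda>k i. x k $ i" 1] by blast
  define v where "v = vec n (\<lambda>i. lim (\<lambda>k. x (r k) $ i))"
  have v: "v \<in> carrier_vec n" by (simp add: v_def)
  have lim: "(\<lambda>k. x (r k) $ i) \<longlonglongrightarrow> v $ i" if "i < n" for i
    using r(2) that by (simp add: v_def convergent_LIMSEQ_iff)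
  have lim_prod: "(\<lambda>k. u \<bullet> x (r k)) \<longlonglongrightarrow> u \<bullet> v" for u
    by (rule tendsto_scalar_prod[OF xc v _ lim]) auto
  have "u \<bullet> v = 0" if "u \<in> F" for u
    using lim_prod[of u] x(1) that W by (simp add: LIMSEQ_const_iff)
  then have "v \<in> W" using v W by auto
  moreover have "v \<bullet> v = 1"
    using tendsto_scalar_prod[OF xc v lim lim] x(2) by (simp add: LIMSEQ_const_iff)
  moreover have "q v \<le> q y" if "y \<in> W" "y \<bullet> y = 1" for y
  proof -
    \<comment> \<open>Each coordinate of \<open>R x\<close> is a scalar product with a row of
      \<open>R\<close>, so the displacement passes to the limit.\<close>
    have "(\<lambda>k. (x (r k) - R *\<^sub>v x (r k)) $ i) \<longlonglongrightarrow> (v - R *\<^sub>v v) $ i" if "i < n" for i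
      using that R v xc carrier_vecD[OF xc] tendsto_diff[OF lim[OF that] lim_prod[of "row R i"]] by simp
    then have "(\<lambda>k. q (x (r k))) \<longlonglongrightarrow> q v"
      unfolding q_def using R v xc by (intro tendsto_scalar_prod[of _ n]) auto
    moreover have "(\<lambda>k. Inf Q + inverse (real (Suc (r k)))) \<longlonglongrightarrow> Inf Q + 0"
      using LIMSEQ_subseq_LIMSEQ[OF LIMSEQ_inverse_real_of_nat r(1)]
      by (intro tendsto_add) (auto simp: o_def)
    ultimately have "q v \<le> Inf Q"
      using x(3) by (intro LIMSEQ_le[of "\<lambda>k. q (x (r k))" "q v"]) (auto intro: less_imp_le)
    also have "\<dots> \<le> q y" using that Q by (auto simp: Q_def intro!: cInf_lower)
    finally show ?thesis .
  qed
  ultimately show ?thesis unfolding q_def by blast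
qed

section \<open>Minimal displacement and eigenvalues\<close>

text \<open>The first-order condition at a minimum: \<open>2 * b\<close> is the derivative at
  \<open>t = 0\<close> of a quadratic that attains its minimum there.\<close>

lemma nonneg_quadratic_linear_coeff_0:
  fixes b c :: real
  assumes "\<And>t. 0 \<le> 2 * t * b + t\<^sup>2 * c"
  shows "b = 0"
proof (rule ccontr)
  assume b: "b \<noteq> 0"
  \<comment> \<open>Opposite in sign to \<open>b\<close> and small enough for the linear term to
    win; the \<open>+ 1\<close> keeps the denominator positive when \<open>c = 0\<close>.\<close>
  define t where "t = - b / (\<bar>c\<bar> + 1)"
  have "2 * t * b + t\<^sup>2 * c \<le> 2 * t * b + t\<^sup>2 * (\<bar>c\<bar> + 1)"
    by (intro add_left_mono mult_left_mono) auto
  also have "\<dots> = - (b\<^sup>2 / (\<bar>c\<bar> + 1))"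
    by (simp add: t_def power2_eq_square divide_simps)
  also have "\<dots> < 0" using b by (simp add: zero_less_divide_iff)
  finally show False using assms[of t] by simp
qed

text \<open>Polarisation: the scalar product is read off from the norm of
  \<open>x + y\<close>.\<close>

lemma isometry_scalar_prod:
  fixes R :: "real mat"
  assumes R: "R \<in> carrier_mat n n" and iso: "\<And>x. x \<in> carrier_vec n \<Longrightarrow> enorm (R *\<^sub>v x) = enorm x"
    and x: "x \<in> carrier_vec n" and y: "y \<in> carrier_vec n"
  shows "(R *\<^sub>v x) \<bullet> (R *\<^sub>v y) = x \<bullet> y"
proof -
  have sq: "(R *\<^sub>v z) \<bullet> (R *\<^sub>v z) = z \<bullet> z" if "z \<in> carrier_vec n" for z
    using iso[OF that] enorm_sq by metis
  have Rxy: "R *\<^sub>v x \<in> carrier_vec n" "R *\<^sub>v y \<in> carrier_vec n" using R x y by auto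
  have exp: "(a + b) \<bullet> (a + b) = a \<bullet> a + 2 * (a \<bullet> b) + b \<bullet> b"
    if "a \<in> carrier_vec n" "b \<in> carrier_vec n" for a b :: "real vec"
    using that comm_scalar_prod[OF that]
    by (simp add: add_scalar_prod_distrib[of _ n] scalar_prod_add_distrib[of _ n])
  show ?thesis
    using sq[of "x + y"] sq[OF x] sq[OF y] exp[OF x y] exp[OF Rxy] x y
      mult_add_distrib_mat_vec[OF R x y] by simp
qed

text \<open>The columns are images of unit vectors, hence orthonormal, and a left inverse of a
  square matrix is also a right inverse. The right-hand form is what turns \<open>R (R^T v)\<close>
  into \<open>v\<close>.\<close>

lemma isometry_transpose:
  fixes R :: "real mat"
  assumes R: "R \<in> carrier_mat n n" and iso: "\<And>x. x \<in> carrier_vec n \<Longrightarrow> enorm (R *\<^sub>v x) = enorm x"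
  shows "R * R\<^sup>T = 1\<^sub>m n"
proof -
  have unit: "R *\<^sub>v unit_vec n k = col R k" if "k < n" for k
    using that R by (intro eq_vecI) auto
  have "R\<^sup>T * R = 1\<^sub>m n"
  proof (rule eq_matI)
    fix i j assume "i < dim_row (1\<^sub>m n :: real mat)" "j < dim_col (1\<^sub>m n :: real mat)"
    then have ij: "i < n" "j < n" by auto
    have "(R\<^sup>T * R) $$ (i, j) = col R i \<bullet> col R j" using ij R by simp
    also have "\<dots> = (R *\<^sub>v unit_vec n i) \<bullet> (R *\<^sub>v unit_vec n j)"
      using ij unit by simp
    also have "\<dots> = unit_vec n i \<bullet> unit_vec n j" by (rule isometry_scalar_prod[OF R iso]) auto
    finally show "(R\<^sup>T * R) $$ (i, j) = 1\<^sub>m n $$ (i, j)" using ij by simp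
  qed (use R in auto)
  then show ?thesis using mat_mult_left_right_inverse R by (metis transpose_carrier_mat)
qed

text \<open>Over the complex numbers the relation factors as
  \<open>(M - cis t) (M - cis (- t)) u = 0\<close>. Either the inner factor already kills
  \<open>u\<close>, or its value \<open>w\<close> is an eigenvector for
  \<open>cis t\<close>.\<close>

lemma eigenvalue_of_cosine_relation:
  fixes R :: "real mat"
  assumes R: "R \<in> carrier_mat n n" and v: "v \<in> carrier_vec n" "v \<noteq> 0\<^sub>v n"
    and rel: "R *\<^sub>v (R *\<^sub>v v) + v = (2 * cos t) \<cdot>\<^sub>v (R *\<^sub>v v)"
  shows "eigenvalue (map_mat complex_of_real R) (cis t) \<or>
    eigenvalue (map_mat complex_of_real R) (cis (- t))"
proof -
  let ?M = "map_mat complex_of_real R"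
  have M: "?M \<in> carrier_mat n n" using R by simp
  define u where "u = map_vec complex_of_real v"
  have u: "u \<in> carrier_vec n" "?M *\<^sub>v u \<in> carrier_vec n" using v M by (auto simp: u_def)
  have u_nz: "u \<noteq> 0\<^sub>v n"
  proof
    assume "u = 0\<^sub>v n"
    then have "v $ i = 0" if "i < n" for i
      using arg_cong[of u _ "\<lambda>v. v $ i"] that v by (simp add: u_def)
    then show False using v by auto
  qed
  have Mu: "?M *\<^sub>v u = map_vec complex_of_real (R *\<^sub>v v)"
    using of_real_hom.mult_mat_vec_hom[OF R v(1)] unfolding u_def by (rule sym)
  have MMu: "?M *\<^sub>v (?M *\<^sub>v u) = map_vec complex_of_real (R *\<^sub>v (R *\<^sub>v v))"
    unfolding Mu by (rule of_real_hom.mult_mat_vec_hom[OF R, symmetric]) (use R v in simp)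
  have cos: "complex_of_real (2 * cos t) = cis t + cis (- t)"
    by (simp add: complex_eq_iff)
  have rel': "(?M *\<^sub>v (?M *\<^sub>v u)) $ i + u $ i = (cis t + cis (- t)) * (?M *\<^sub>v u) $ i" if "i < n" for i
    using arg_cong[OF rel, of "\<lambda>v. complex_of_real (v $ i)"] that R v
    unfolding MMu unfolding Mu cos[symmetric] by (simp add: u_def)
  define w where "w = ?M *\<^sub>v u - cis (- t) \<cdot>\<^sub>v u"
  have w: "w \<in> carrier_vec n" using u by (simp add: w_def)
  show ?thesis
  proof (cases "w = 0\<^sub>v n")
    case True
    have "?M *\<^sub>v u = cis (- t) \<cdot>\<^sub>v u"
    proof (rule eq_vecI)
      fix i assume "i < dim_vec (cis (- t) \<cdot>\<^sub>v u)"
      then show "(?M *\<^sub>v u) $ i = (cis (- t) \<cdot>\<^sub>v u) $ i"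
        using arg_cong[OF True, of "\<lambda>v. v $ i"] u by (simp add: w_def del: index_mult_mat_vec)
    qed (use u R in auto)
    then have "eigenvalue ?M (cis (- t))"
      using u u_nz M R unfolding eigenvalue_def eigenvector_def by auto
    then show ?thesis ..
  next
    case False
    have "?M *\<^sub>v w = ?M *\<^sub>v (?M *\<^sub>v u) - cis (- t) \<cdot>\<^sub>v (?M *\<^sub>v u)"
      using u mult_minus_distrib_mat_vec[OF M u(2), of "cis (- t) \<cdot>\<^sub>v u"]
      by (simp add: w_def mult_mat_vec[OF M])
    also have "\<dots> = cis t \<cdot>\<^sub>v w"
    proof (rule eq_vecI)
      fix i assume "i < dim_vec (cis t \<cdot>\<^sub>v w)"
      then have i: "i < n" using w by simp
      have "cis t * cis (- t) = 1" by (simp add: cis_mult)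
      then have e: "cis t * (cis (- t) * u $ i) = u $ i" by (simp flip: mult.assoc)
      show "(?M *\<^sub>v (?M *\<^sub>v u) - cis (- t) \<cdot>\<^sub>v (?M *\<^sub>v u)) $ i = (cis t \<cdot>\<^sub>v w) $ i"
        using rel'[OF i] i u M by (simp add: w_def algebra_simps e del: index_mult_mat_vec)
    qed (use u w M in auto)
    finally have "eigenvalue ?M (cis t)"
      using w False M R unfolding eigenvalue_def eigenvector_def by auto
    then show ?thesis ..
  qed
qed

text \<open>The eigenvalue comes from a minimiser \<open>v\<close> of the displacement on the unit sphere of \<open>W\<close>: it
  satisfies \<open>R v + R\<^sup>T v = (2 - \<mu>) v\<close> for the minimum \<open>\<mu> = 2 - 2 cos t\<close>.\<close>

lemma isometry_displacement_gap:
  fixes R :: "real mat"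
  assumes R: "R \<in> carrier_mat n n" and iso: "\<And>x. x \<in> carrier_vec n \<Longrightarrow> enorm (R *\<^sub>v x) = enorm x"
    and W: "W = {x \<in> carrier_vec n. \<forall>u\<in>carrier_vec n. R *\<^sub>v u = u \<longrightarrow> u \<bullet> x = 0}"
    and x0: "x0 \<in> W" "x0 \<noteq> 0\<^sub>v n"
  shows "\<exists>t. t \<noteq> 0 \<and> \<bar>t\<bar> \<le> pi \<and> eigenvalue (map_mat complex_of_real R) (cis t) \<and>
    (\<forall>x\<in>W. (2 - 2 * cos t) * (enorm x)\<^sup>2 \<le> (enorm (x - R *\<^sub>v x))\<^sup>2)"
proof -
  define F where "F = {u \<in> carrier_vec n. R *\<^sub>v u = u}"
  have W': "W = {x \<in> carrier_vec n. \<forall>u\<in>F. u \<bullet> x = 0}" and F: "F \<subseteq> carrier_vec n"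
    by (auto simp: W F_def)
  define B where "B x y = (x - R *\<^sub>v x) \<bullet> (y - R *\<^sub>v y)" for x y
  have Wc: "x \<in> carrier_vec n" if "x \<in> W" for x using that W by simp
  have Rc: "R *\<^sub>v x \<in> carrier_vec n" if "x \<in> carrier_vec n" for x using that R by simp
  note R_add = mult_add_distrib_mat_vec[OF R]
  note R_smult = mult_mat_vec[OF R]
  have W_smult: "c \<cdot>\<^sub>v x \<in> W" if "x \<in> W" for c x
    using that by (auto simp: W)
  have W_add: "x + y \<in> W" if "x \<in> W" "y \<in> W" for x y
    using that by (auto simp: W scalar_prod_add_distrib[of _ n])
  have B_smult: "B (c \<cdot>\<^sub>v x) (c \<cdot>\<^sub>v x) = c\<^sup>2 * B x x" if "x \<in> carrier_vec n" for c x
  proof -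
    have "c \<cdot>\<^sub>v x - R *\<^sub>v (c \<cdot>\<^sub>v x) = c \<cdot>\<^sub>v (x - R *\<^sub>v x)"
      using that Rc[OF that] unfolding R_smult[OF that]
      by (intro eq_vecI) (auto simp: right_diff_distrib simp del: index_mult_mat_vec dim_mult_mat_vec)
    then show ?thesis by (simp add: B_def power2_eq_square)
  qed
  have B_add: "B (x + y) (x + y) = B x x + 2 * B x y + B y y"
    if "x \<in> carrier_vec n" "y \<in> carrier_vec n" for x y
  proof -
    let ?x = "x - R *\<^sub>v x" and ?y = "y - R *\<^sub>v y"
    have c: "?x \<in> carrier_vec n" "?y \<in> carrier_vec n" using that Rc by auto
    have "(x + y) - R *\<^sub>v (x + y) = ?x + ?y"
      using that Rc[OF that(1)] Rc[OF that(2)] unfolding R_add[OF that]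
      by (intro eq_vecI) (auto simp del: index_mult_mat_vec dim_mult_mat_vec)
    then show ?thesis
      using c comm_scalar_prod[OF c]
      by (simp add: B_def add_scalar_prod_distrib[of _ n] scalar_prod_add_distrib[of _ n])
  qed
  have normalise: "((1 / enorm x) \<cdot>\<^sub>v x) \<bullet> ((1 / enorm x) \<cdot>\<^sub>v x) = 1"
    if "x \<in> carrier_vec n" "x \<noteq> 0\<^sub>v n" for x
    using scalar_prod_self_eq_0_iff[OF that(1)] that by (simp add: enorm_def scalar_prod_self_nonneg)
  \<comment> \<open>The normalised \<open>x0\<close> shows that the unit sphere of \<open>W\<close>
    is nonempty.\<close>
  obtain v where v: "v \<in> W" "v \<bullet> v = 1" "\<And>x. x \<in> W \<Longrightarrow> x \<bullet> x = 1 \<Longrightarrow> B v v \<le> B x x"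
    using displacement_attains_min[OF R F W' W_smult[OF x0(1)] normalise] x0 Wc
    unfolding B_def by metis
  define \<mu> where "\<mu> = B v v"
  have vc: "v \<in> carrier_vec n" "v \<noteq> 0\<^sub>v n" using v(1,2) Wc by auto
  have min: "\<mu> * (x \<bullet> x) \<le> B x x" if x: "x \<in> W" for x
  proof (cases "x = 0\<^sub>v n")
    case True
    then show ?thesis by (simp add: B_def scalar_prod_self_nonneg)
  next
    case False
    then have pos: "(enorm x)\<^sup>2 > 0" using enorm_eq_0_iff Wc[OF x] by simp
    have "\<mu> \<le> (1 / enorm x)\<^sup>2 * B x x"
      using v(3)[OF W_smult[OF x] normalise[OF Wc[OF x] False]] B_smult[OF Wc[OF x]]
      unfolding \<mu>_def by simp
    then show ?thesis using pos by (simp add: power_divide pos_le_divide_eq flip: enorm_sq)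
  qed
  \<comment> \<open>If the minimum were zero, \<open>v\<close> would be a fixed vector in
    \<open>W\<close>, hence orthogonal to itself.\<close>
  have "B v v \<noteq> 0"
  proof
    assume "B v v = 0"
    then have z: "v - R *\<^sub>v v = 0\<^sub>v n"
      using scalar_prod_self_eq_0_iff[of "v - R *\<^sub>v v" n] vc(1) Rc[OF vc(1)] by (simp add: B_def)
    have "R *\<^sub>v v = v"
    proof (rule eq_vecI)
      fix i assume "i < dim_vec v"
      then show "(R *\<^sub>v v) $ i = v $ i"
        using arg_cong[OF z, of "\<lambda>x. x $ i"] vc(1) Rc[OF vc(1)]
        by (simp del: index_mult_mat_vec dim_mult_mat_vec)
    qed (use vc R in auto)
    then show False using v(1,2) vc(1) by (auto simp: W)
  qed
  then have mu_pos: "\<mu> > 0" using scalar_prod_self_nonneg[of "v - R *\<^sub>v v"] by (simp add: \<mu>_def B_def)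
  have ev: "enorm v = 1" using v(2) by (simp add: enorm_def)
  then have "enorm (v - R *\<^sub>v v) \<le> 2"
    using enorm_minus[of v n "R *\<^sub>v v"] iso[of v] vc Rc by simp
  \<comment> \<open>This keeps \<open>1 - \<mu> / 2\<close> at least \<open>-1\<close>, as
    \<open>arccos\<close> requires.\<close>
  then have mu_le: "\<mu> \<le> 4"
    using power_mono[of "enorm (v - R *\<^sub>v v)" 2 2] by (simp add: \<mu>_def B_def enorm_sq)
  have sp: "(R *\<^sub>v x) \<bullet> (R *\<^sub>v y) = x \<bullet> y" if "x \<in> carrier_vec n" "y \<in> carrier_vec n" for x y
    using isometry_scalar_prod[OF R iso that] .
  have tr: "(R\<^sup>T *\<^sub>v y) \<bullet> x = y \<bullet> (R *\<^sub>v x)" if "x \<in> carrier_vec n" "y \<in> carrier_vec n" for x y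
    using transpose_vec_mult_scalar[OF R that] .
  have Rt: "R\<^sup>T \<in> carrier_mat n n" using R by simp
  \<comment> \<open>Half the gradient of \<open>B x x - \<mu> * (x \<bullet> x)\<close> at
    \<open>v\<close>. It is orthogonal to \<open>W\<close> by minimality, and lies in
    \<open>W\<close> because it is orthogonal to all fixed vectors; so it vanishes.\<close>
  define g where "g = (2 - \<mu>) \<cdot>\<^sub>v v - (R *\<^sub>v v + R\<^sup>T *\<^sub>v v)"
  have Rv: "R *\<^sub>v v \<in> carrier_vec n" "R\<^sup>T *\<^sub>v v \<in> carrier_vec n" using vc Rt R by auto
  have gc: "g \<in> carrier_vec n" using vc Rv by (simp add: g_def)
  have g_prod: "g \<bullet> w = B v w - \<mu> * (v \<bullet> w)" if w: "w \<in> carrier_vec n" for w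
    using vc w Rv Rc[OF w] tr[OF w vc(1)] sp[OF vc(1) w]
    by (simp add: g_def B_def minus_scalar_prod_distrib[of _ n] scalar_prod_minus_distrib[of _ n]
        add_scalar_prod_distrib[of _ n] algebra_simps)
  have g_W: "g \<bullet> w = 0" if w: "w \<in> W" for w
  proof (rule nonneg_quadratic_linear_coeff_0)
    fix t :: real
    have wc: "w \<in> carrier_vec n" "t \<cdot>\<^sub>v w \<in> carrier_vec n" using Wc w by auto
    have Bt: "B v (t \<cdot>\<^sub>v w) = t * B v w"
      using wc vc Rv Rc[OF wc(1)]
      by (simp add: B_def R_smult minus_scalar_prod_distrib[of _ n] scalar_prod_minus_distrib[of _ n] algebra_simps)
    have "(v + t \<cdot>\<^sub>v w) \<bullet> (v + t \<cdot>\<^sub>v w) = v \<bullet> v + 2 * t * (v \<bullet> w) + t\<^sup>2 * (w \<bullet> w)"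
      using wc vc comm_scalar_prod[OF vc(1) wc(1)]
      by (simp add: add_scalar_prod_distrib[of _ n] scalar_prod_add_distrib[of _ n] power2_eq_square algebra_simps)
    moreover have "B (v + t \<cdot>\<^sub>v w) (v + t \<cdot>\<^sub>v w) = \<mu> + 2 * t * B v w + t\<^sup>2 * B w w"
      using B_add[OF vc(1) wc(2)] B_smult[OF wc(1)] Bt by (simp add: \<mu>_def)
    ultimately have "\<mu> * (1 + 2 * t * (v \<bullet> w) + t\<^sup>2 * (w \<bullet> w)) \<le> \<mu> + 2 * t * B v w + t\<^sup>2 * B w w"
      using min[OF W_add[OF v(1) W_smult[OF w]], of t] v(2) by simp
    then show "0 \<le> 2 * t * (g \<bullet> w) + t\<^sup>2 * (B w w - \<mu> * (w \<bullet> w))"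
      unfolding g_prod[OF wc(1)] by (simp add: algebra_simps)
  qed
  have "u \<bullet> g = 0" if u: "u \<in> carrier_vec n" "R *\<^sub>v u = u" for u
  proof -
    have "v \<bullet> u = 0"
      using v(1) u comm_scalar_prod[OF vc(1) u(1)] by (simp add: W)
    moreover have "B v u = 0"
      using u vc Rv by (simp add: B_def scalar_prod_minus_distrib[of _ n])
    ultimately show ?thesis using g_prod[OF u(1)] comm_scalar_prod[OF gc u(1)] by simp
  qed
  then have "g \<in> W" using gc by (simp add: W)
  then have g0: "g = 0\<^sub>v n" using g_W scalar_prod_self_eq_0_iff[OF gc] by blast
  define t where "t = arccos (1 - \<mu> / 2)"
  have cos_t: "cos t = 1 - \<mu> / 2" and t: "0 \<le> t" "t \<le> pi"
    using mu_pos mu_le by (auto simp: t_def arccos_lbound arccos_ubound)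
  have t_nz: "t \<noteq> 0" using cos_t mu_pos by auto
  have sum: "R *\<^sub>v v + R\<^sup>T *\<^sub>v v = (2 * cos t) \<cdot>\<^sub>v v"
  proof (rule eq_vecI)
    fix i assume "i < dim_vec ((2 * cos t) \<cdot>\<^sub>v v)"
    then show "(R *\<^sub>v v + R\<^sup>T *\<^sub>v v) $ i = ((2 * cos t) \<cdot>\<^sub>v v) $ i"
      using arg_cong[OF g0, of "\<lambda>x. x $ i"] vc carrier_vecD[OF Rv(1)] carrier_vecD[OF Rv(2)]
      by (simp add: g_def cos_t algebra_simps del: index_mult_mat_vec dim_mult_mat_vec)
  qed (use vc R in simp)
  \<comment> \<open>Applying \<open>R\<close> to \<open>sum\<close> removes the transpose.\<close>
  have "R *\<^sub>v (R *\<^sub>v v) + v = R *\<^sub>v (R *\<^sub>v v) + R *\<^sub>v (R\<^sup>T *\<^sub>v v)"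
    using isometry_transpose[OF R iso] assoc_mult_mat_vec[OF R Rt vc(1)] vc by simp
  also have "\<dots> = (2 * cos t) \<cdot>\<^sub>v (R *\<^sub>v v)"
    using R_add[OF Rv] sum R_smult[OF vc(1)] by simp
  finally have "eigenvalue (map_mat complex_of_real R) (cis t) \<or>
      eigenvalue (map_mat complex_of_real R) (cis (- t))"
    by (rule eigenvalue_of_cosine_relation[OF R vc])
  moreover have "\<forall>x\<in>W. (2 - 2 * cos t) * (enorm x)\<^sup>2 \<le> (enorm (x - R *\<^sub>v x))\<^sup>2"
    using min by (simp add: cos_t enorm_sq B_def)
  ultimately show ?thesis
    using t t_nz by (elim disjE) (rule exI[of _ t], simp, rule exI[of _ "- t"], simp)
qed

section \<open>Angles and the eigengap\<close>

text \<open>The right-hand side is \<open>4 * (sin (t / 2))^2\<close>, and the crude bound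
  \<open>sin x \<ge> x / 3\<close> for \<open>x\<close> from 0 to 2 suffices. The 9 becomes the
  factor 3 in the displacement estimate.\<close>

lemma chord_ge:
  assumes "\<bar>t\<bar> \<le> pi"
  shows "t\<^sup>2 / 9 \<le> 2 - 2 * cos t"
proof -
  define x where "x = \<bar>t\<bar> / 2"
  have x: "0 \<le> x" "x \<le> 2" using assms pi_less_4 by (auto simp: x_def)
  have "\<bar>sin x - x\<bar> \<le> x ^ 3 / 6"
    using Maclaurin_sin_bound[of x 3] x
    by (simp add: sin_coeff_def eval_nat_numeral fact_num_eq_if)
  also have "\<dots> = x * x\<^sup>2 / 6" by (simp add: eval_nat_numeral)
  also have "\<dots> \<le> x * 2\<^sup>2 / 6" using x by (intro divide_right_mono mult_left_mono power_mono) auto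
  finally have "\<bar>sin x - x\<bar> \<le> 2 / 3 * x" by simp
  then have "x / 3 \<le> sin x" by linarith
  then have "(x / 3)\<^sup>2 \<le> (sin x)\<^sup>2" using x by (intro power_mono) auto
  moreover have "cos t = 1 - 2 * (sin x)\<^sup>2"
    using cos_double_sin[of x] by (simp add: x_def)
  ultimately show ?thesis by (simp add: x_def power_divide)
qed

text \<open>An angle is the argument of its eigenvalue, except for \<open>- pi\<close>, which
  \<open>Arg\<close> never returns; hence the inserted \<open>pi\<close>.\<close>

lemma finite_unit_eigenangles:
  assumes "M \<in> carrier_mat n n"
  shows "finite {\<bar>\<theta>\<bar> | \<theta>. \<bar>\<theta>\<bar> \<le> pi \<and> \<theta> \<noteq> 0 \<and> eigenvalue M (cis \<theta>)}"
proof -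
  have "{\<bar>\<theta>\<bar> | \<theta>. \<bar>\<theta>\<bar> \<le> pi \<and> \<theta> \<noteq> 0 \<and> eigenvalue M (cis \<theta>)} \<subseteq>
      insert pi ((\<lambda>z. \<bar>Arg z\<bar>) ` {z. eigenvalue M z})"
  proof clarify
    fix \<theta> assume *: "\<bar>\<theta>\<bar> \<le> pi" "\<bar>\<theta>\<bar> \<notin> (\<lambda>z. \<bar>Arg z\<bar>) ` {z. eigenvalue M z}" "eigenvalue M (cis \<theta>)"
    have "Arg (cis \<theta>) = \<theta>" if "\<theta> \<noteq> - pi"
      using that *(1) by (intro cis_Arg_unique) (auto simp: sgn_div_norm)
    then show "\<bar>\<theta>\<bar> = pi" using *(2,3) by force
  qed
  moreover have "finite {z. eigenvalue M z}"
    using card_finite_spectrum(1)[OF assms] by (simp add: spectrum_def)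
  ultimately show ?thesis by (meson finite_imageI finite_insert finite_subset)
qed

text \<open>The nonzero vector \<open>x0\<close> guarantees that the minimum in \<open>eigengap_inv\<close> is over a nonempty
  set.\<close>

lemma eigengap_displacement:
  assumes R: "refl_mat A \<in> carrier_mat n n"
    and iso: "\<And>x. x \<in> carrier_vec n \<Longrightarrow> enorm (refl_mat A *\<^sub>v x) = enorm x"
    and W: "W = {x \<in> carrier_vec n. \<forall>u\<in>carrier_vec n. refl_mat A *\<^sub>v u = u \<longrightarrow> u \<bullet> x = 0}"
    and x0: "x0 \<in> W" "x0 \<noteq> 0\<^sub>v n"
  shows "1 / 4 \<le> eigengap_inv A"
    and "x \<in> W \<Longrightarrow> enorm x \<le> 3 * eigengap_inv A * enorm (x - refl_mat A *\<^sub>v x)"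
proof -
  let ?R = "refl_mat A"
  define T where "T = {\<bar>\<theta>\<bar> | \<theta>. \<bar>\<theta>\<bar> \<le> pi \<and> \<theta> \<noteq> 0 \<and> eigenvalue (map_mat complex_of_real ?R) (cis \<theta>)}"
  have fin: "finite T" unfolding T_def by (rule finite_unit_eigenangles[of _ n]) (use R in simp)
  obtain t where t: "t \<noteq> 0" "\<bar>t\<bar> \<le> pi" "eigenvalue (map_mat complex_of_real ?R) (cis t)"
    "\<And>x. x \<in> W \<Longrightarrow> (2 - 2 * cos t) * (enorm x)\<^sup>2 \<le> (enorm (x - ?R *\<^sub>v x))\<^sup>2"
    using isometry_displacement_gap[OF R iso W x0] by blast
  have tT: "\<bar>t\<bar> \<in> T" using t by (auto simp: T_def)
  \<comment> \<open>The angle \<open>t\<close> is among the candidates, so the minimal angle gives a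
    weaker, still valid estimate. With \<open>pi < 4\<close> it also bounds
    \<open>eigengap_inv\<close> from below.\<close>
  have Min: "Min T \<in> T" "Min T \<le> \<bar>t\<bar>" using fin tT by (auto intro: Min_in)
  then have pos: "0 < Min T" "Min T \<le> 4" using t(2) pi_less_4 by (auto simp: T_def)
  have eta: "eigengap_inv A = 1 / Min T" by (simp add: eigengap_inv_def T_def)
  show "1 / 4 \<le> eigengap_inv A" using pos by (simp add: eta field_simps)
  assume x: "x \<in> W"
  have "(Min T)\<^sup>2 \<le> t\<^sup>2" using power_mono[OF Min(2), of 2] pos(1) by simp
  then have "(Min T)\<^sup>2 / 9 \<le> 2 - 2 * cos t" using chord_ge[OF t(2)] by linarith
  then have "(Min T)\<^sup>2 / 9 * (enorm x)\<^sup>2 \<le> (2 - 2 * cos t) * (enorm x)\<^sup>2"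
    by (rule mult_right_mono) simp
  then have "(Min T)\<^sup>2 / 9 * (enorm x)\<^sup>2 \<le> (enorm (x - ?R *\<^sub>v x))\<^sup>2" using t(4)[OF x] by linarith
  then have "(Min T / 3 * enorm x)\<^sup>2 \<le> (enorm (x - ?R *\<^sub>v x))\<^sup>2"
    by (simp add: power_mult_distrib power_divide)
  then have "Min T / 3 * enorm x \<le> enorm (x - ?R *\<^sub>v x)" by (rule power2_le_imp_le) simp
  then show "enorm x \<le> 3 * eigengap_inv A * enorm (x - ?R *\<^sub>v x)"
    using pos by (simp add: eta field_simps)
qed

subsection \<open>Sums along orbits\<close>

abbreviation vsum :: "nat \<Rightarrow> (nat \<Rightarrow> real vec) \<Rightarrow> nat \<Rightarrow> real vec" where
  "vsum n f N \<equiv> finsum_vec TYPE(real) n f {..<N}"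

lemma vsum_carrier [simp]: "(\<And>k. f k \<in> carrier_vec n) \<Longrightarrow> vsum n f N \<in> carrier_vec n"
  by (intro finsum_vec_closed) auto

lemma vsum_index: "(\<And>k. f k \<in> carrier_vec n) \<Longrightarrow> i < n \<Longrightarrow> vsum n f N $ i = (\<Sum>k<N. f k $ i)"
  by (intro index_finsum_vec) auto

lemma finsum_vec_real_empty [simp]: "finsum_vec TYPE(real) n f {} = 0\<^sub>v n"
  by (rule finsum_vec_empty)

lemma vsum_Suc: "(\<And>k. f k \<in> carrier_vec n) \<Longrightarrow> vsum n f (Suc N) = vsum n f N + f N"
  by (intro eq_vecI) (auto simp: vsum_index carrier_vecD[of _ n])

lemma vsum_add:
  assumes f: "\<And>k. f k \<in> carrier_vec n"
  shows "vsum n f (M + N) = vsum n f M + vsum n (\<lambda>k. f (M + k)) N"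
proof (induction N)
  case 0
  show ?case using vsum_carrier[of f n M] f by simp
next
  case (Suc N)
  then show ?case
    using f by (simp add: vsum_Suc assoc_add_vec[of _ n])
qed

lemma enorm_vsum_le:
  assumes "\<And>k. f k \<in> carrier_vec n" "\<And>k. k < N \<Longrightarrow> enorm (f k) \<le> B"
  shows "enorm (vsum n f N) \<le> real N * B"
  using assms(2)
proof (induction N)
  case (Suc N)
  have "enorm (vsum n f (Suc N)) \<le> enorm (vsum n f N) + enorm (f N)"
    unfolding vsum_Suc[OF assms(1)] by (rule enorm_triangle) (use assms(1) in auto)
  also have "\<dots> \<le> real N * B + B" using Suc by (intro add_mono) auto
  finally show ?case by (simp add: algebra_simps)
qed simp

lemma mult_mat_vec_vsum:
  assumes R: "R \<in> carrier_mat n n" and f: "\<And>k. f k \<in> carrier_vec n"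
  shows "R *\<^sub>v vsum n f N = vsum n (\<lambda>k. R *\<^sub>v f k) N"
proof (induction N)
  case 0
  show ?case using R by (intro eq_vecI) auto
next
  case (Suc N)
  then show ?case
    using R f by (simp add: vsum_Suc mult_add_distrib_mat_vec[of _ n n])
qed

lemma scalar_prod_vsum_0:
  assumes f: "\<And>k. f k \<in> carrier_vec n" and u: "u \<in> carrier_vec n" "\<And>k. u \<bullet> f k = 0"
  shows "u \<bullet> vsum n f N = 0"
  by (induction N) (use f u in \<open>auto simp: vsum_Suc scalar_prod_add_distrib[of _ n]\<close>)

text \<open>Writing \<open>k = i * m + j\<close> and exchanging the sums groups the terms by their
  position \<open>j\<close> within a block.\<close>

lemma vsum_block:
  assumes f: "\<And>k. f k \<in> carrier_vec n"
  shows "vsum n f (q * m) = vsum n (\<lambda>j. vsum n (\<lambda>i. f (i * m + j)) q) m"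
proof (rule eq_vecI)
  fix l assume "l < dim_vec (vsum n (\<lambda>j. vsum n (\<lambda>i. f (i * m + j)) q) m)"
  then have l: "l < n" using vsum_carrier f carrier_vecD by metis
  have "(\<Sum>k<q * m. f k $ l) = (\<Sum>i<q. \<Sum>k = i * m..<i * m + m. f k $ l)"
    by (rule sum.nat_group[symmetric])
  also have "\<dots> = (\<Sum>i<q. \<Sum>j<m. f (i * m + j) $ l)"
    by (simp add: sum.atLeastLessThan_shift_0[of _ "_ * m"] lessThan_atLeast0 add.commute)
  also have "\<dots> = (\<Sum>j<m. \<Sum>i<q. f (i * m + j) $ l)"
    by (rule sum.swap)
  finally show "vsum n f (q * m) $ l = vsum n (\<lambda>j. vsum n (\<lambda>i. f (i * m + j)) q) m $ l"
    using f l by (simp add: vsum_index)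
qed (use f in \<open>simp add: carrier_vecD[of _ n]\<close>)

lemma average_minus:
  assumes x: "\<And>k. x k \<in> carrier_vec n" and xs: "xs \<in> carrier_vec n" and N: "0 < N"
  shows "average n x N - xs = (1 / real N) \<cdot>\<^sub>v vsum n (\<lambda>k. x k - xs) N"
proof (rule eq_vecI)
  fix i assume "i < dim_vec ((1 / real N) \<cdot>\<^sub>v vsum n (\<lambda>k. x k - xs) N)"
  then have i: "i < n" using carrier_vecD[OF vsum_carrier[of "\<lambda>k. x k - xs" n N]] x xs by simp
  have d: "dim_vec (vsum n x N) = n" "dim_vec (vsum n (\<lambda>k. x k - xs) N) = n"
    using carrier_vecD[OF vsum_carrier[of "\<lambda>k. x k - xs" n N]] carrier_vecD[OF vsum_carrier[of x n N]] x xs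
    by auto
  have "average n x N $ i = 1 / real N * vsum n x N $ i"
    unfolding average_def by (rule index_smult_vec) (simp only: d i)
  moreover have "((1 / real N) \<cdot>\<^sub>v vsum n (\<lambda>k. x k - xs) N) $ i = 1 / real N * vsum n (\<lambda>k. x k - xs) N $ i"
    by (rule index_smult_vec) (simp only: d i)
  ultimately show "(average n x N - xs) $ i = ((1 / real N) \<cdot>\<^sub>v vsum n (\<lambda>k. x k - xs) N) $ i"
    using i N x xs
    by (simp only: index_minus_vec carrier_vecD) (simp add: vsum_index sum_subtractf field_simps)
qed (use x xs in \<open>simp add: average_def carrier_vecD[of _ n]\<close>)

text \<open>The sum of the first \<open>N\<close> iterates of an isometry lies in \<open>W\<close>, and its displacement
  telescopes to \<open>y 0 - y N\<close>.\<close>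

lemma enorm_orbit_sum_le:
  fixes A :: "real mat" and y :: "nat \<Rightarrow> real vec"
  assumes R: "refl_mat A \<in> carrier_mat n n"
    and iso: "\<And>x. x \<in> carrier_vec n \<Longrightarrow> enorm (refl_mat A *\<^sub>v x) = enorm x"
    and W: "W = {x \<in> carrier_vec n. \<forall>u\<in>carrier_vec n. refl_mat A *\<^sub>v u = u \<longrightarrow> u \<bullet> x = 0}"
    and x0: "x0 \<in> W" "x0 \<noteq> 0\<^sub>v n"
    and y: "y 0 \<in> W" "\<And>k. y (Suc k) = refl_mat A *\<^sub>v y k"
  shows "enorm (vsum n y N) \<le> 6 * eigengap_inv A * enorm (y 0)"
proof -
  let ?R = "refl_mat A"
  note gap = eigengap_displacement[OF R iso W x0]
  have yc: "y k \<in> carrier_vec n" and yn: "enorm (y k) = enorm (y 0)" for k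
    by (induction k) (use y R iso W in auto)
  have orth: "u \<bullet> y k = 0" if u: "u \<in> carrier_vec n" "?R *\<^sub>v u = u" for u k
  proof (induction k)
    case (Suc k)
    \<comment> \<open>\<open>?R\<close> fixes \<open>u\<close> and preserves scalar products, so
      orthogonality is inherited along the orbit.\<close>
    have "u \<bullet> y (Suc k) = (?R *\<^sub>v u) \<bullet> (?R *\<^sub>v y k)" using u y by simp
    also have "\<dots> = u \<bullet> y k" by (rule isometry_scalar_prod[OF R iso u(1) yc])
    finally show ?case using Suc by simp
  qed (use u y W in auto)
  have "vsum n y N \<in> W"
    using yc orth by (auto simp: W intro!: scalar_prod_vsum_0)
  moreover have "vsum n y N - ?R *\<^sub>v vsum n y N = y 0 - y N"
  proof (induction N)
    case 0
    show ?case using R yc[of 0] by (intro eq_vecI) auto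
  next
    case (Suc N)
    have c: "vsum n y N \<in> carrier_vec n" "?R *\<^sub>v vsum n y N \<in> carrier_vec n"
      using yc R by (auto intro!: mult_mat_vec_carrier)
    have "?R *\<^sub>v vsum n y (Suc N) = ?R *\<^sub>v vsum n y N + y (Suc N)"
      using yc by (simp add: vsum_Suc mult_add_distrib_mat_vec[OF R c(1)] y(2))
    then have "vsum n y (Suc N) - ?R *\<^sub>v vsum n y (Suc N)
        = (vsum n y N - ?R *\<^sub>v vsum n y N) + (y N - y (Suc N))"
      using c yc
      by (intro eq_vecI) (simp_all add: vsum_Suc carrier_vecD[OF c(1)] carrier_vecD[OF c(2)]
        carrier_vecD[OF yc] del: index_mult_mat_vec dim_mult_mat_vec)
    then show ?case
      unfolding Suc using carrier_vecD[OF yc] by (intro eq_vecI) auto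
  qed
  ultimately have "enorm (vsum n y N) \<le> 3 * eigengap_inv A * enorm (y 0 - y N)"
    using gap(2) by metis
  also have "\<dots> \<le> 3 * eigengap_inv A * (2 * enorm (y 0))"
    using gap(1) enorm_minus[OF yc yc, of 0 N] yn[of N] by (intro mult_left_mono) auto
  finally show ?thesis by simp
qed

section \<open>Cyclic reflections in blocks of length \<open>m\<close>\<close>

lemma reflection_orbit:
  fixes y :: "nat \<Rightarrow> real vec"
  assumes A: "A \<in> carrier_mat m n" and y0: "y 0 \<in> carrier_vec n"
    and y: "\<And>k. y (Suc k) = reflection n (row A (k mod m)) *\<^sub>v y k"
  shows "y k \<in> carrier_vec n"
    and "enorm (y k) = enorm (y 0)"
    and "0 < m \<Longrightarrow> y (Suc i * m) = refl_mat A *\<^sub>v y (i * m)"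
proof -
  have row: "row A k \<in> carrier_vec n" for k using A by auto
  show yc: "y k \<in> carrier_vec n" for k
    by (induction k) (use y0 y row in \<open>auto intro!: mult_mat_vec_carrier\<close>)
  show "enorm (y k) = enorm (y 0)"
    by (induction k) (use y row yc enorm_reflection in auto)
  assume m: "0 < m"
  have rows: "set (take j (rows A)) \<subseteq> carrier_vec n" for j
    using rows_carrier[of A] A set_take_subset[of j "rows A"] by auto
  \<comment> \<open>After \<open>j\<close> steps of a block exactly the first \<open>j\<close> rows
    have acted, as \<open>(i * m + j) mod m = j\<close> for \<open>j < m\<close>; the case
    \<open>j = m\<close> completes the block.\<close>
  have "j \<le> m \<Longrightarrow> y (i * m + j) = reflection_prod n (take j (rows A)) *\<^sub>v y (i * m)" for j
  proof (induction j)
    case 0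
    show ?case using yc by simp
  next
    case (Suc j)
    have "take (Suc j) (rows A) = take j (rows A) @ [row A j]"
      using Suc.prems A by (simp add: take_Suc_conv_app_nth)
    then have "reflection_prod n (take (Suc j) (rows A)) *\<^sub>v y (i * m)
        = reflection n (row A j) *\<^sub>v (reflection_prod n (take j (rows A)) *\<^sub>v y (i * m))"
      using assoc_mult_mat_vec[OF reflection_carrier[OF row] reflection_prod_carrier[OF rows] yc]
      by simp
    moreover have "(i * m + j) mod m = j" using Suc.prems by simp
    ultimately show ?case using Suc y[of "i * m + j"] by simp
  qed
  from this[of m] show "y (Suc i * m) = refl_mat A *\<^sub>v y (i * m)"
    using A by (simp add: refl_mat_def add.commute)
qed

text \<open>Within the blocks of length \<open>m\<close>, the sum over the \<open>j\<close>-th positions is the image of the sum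
  over the initial positions under \<open>j\<close> reflections, so it has the same norm.\<close>

lemma enorm_full_orbit_sum_le:
  fixes y :: "nat \<Rightarrow> real vec"
  assumes A: "A \<in> carrier_mat m n" and m: "0 < m" and y0: "y 0 \<in> carrier_vec n"
    and y: "\<And>k. y (Suc k) = reflection n (row A (k mod m)) *\<^sub>v y k"
    and K: "\<And>q. enorm (vsum n (\<lambda>i. y (i * m)) q) \<le> K"
  shows "enorm (vsum n y N) \<le> real m * K + real m * enorm (y 0)"
proof -
  note yc = reflection_orbit(1)[OF A y0 y] and yn = reflection_orbit(2)[OF A y0 y]
  have row: "row A k \<in> carrier_vec n" for k using A by auto
  define U where "U j q = vsum n (\<lambda>i. y (i * m + j)) q" for j q
  have Uc: "U j q \<in> carrier_vec n" for j q using yc by (simp add: U_def)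
  have U: "j < m \<Longrightarrow> enorm (U j q) \<le> K" for j q
  proof (induction j)
    case 0
    show ?case using K by (simp add: U_def)
  next
    case (Suc j)
    have "U (Suc j) q = reflection n (row A j) *\<^sub>v U j q"
      using Suc.prems mult_mat_vec_vsum[OF reflection_carrier[OF row] yc] by (simp add: U_def y)
    then show ?case using Suc enorm_reflection[OF row Uc] by simp
  qed
  define q where "q = N div m"
  define r where "r = N mod m"
  \<comment> \<open>What remains after the full blocks is fewer than \<open>m\<close> vectors, each
    with the norm of \<open>y 0\<close>.\<close>
  have N: "N = q * m + r" by (simp add: q_def r_def)
  have "enorm (vsum n y N) \<le> enorm (vsum n y (q * m)) + enorm (vsum n (\<lambda>k. y (q * m + k)) r)"
    unfolding N vsum_add[OF yc] by (rule enorm_triangle[where n = n]) (use yc in auto)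
  also have "enorm (vsum n y (q * m)) \<le> real m * K"
    unfolding vsum_block[OF yc] using U Uc by (intro enorm_vsum_le) (auto simp: U_def)
  also have "enorm (vsum n (\<lambda>k. y (q * m + k)) r) \<le> real r * enorm (y 0)"
    by (rule enorm_vsum_le[OF yc eq_refl[OF yn]])
  also have "\<dots> \<le> real m * enorm (y 0)"
    using m by (intro mult_right_mono) (auto simp: r_def less_imp_le)
  finally show ?thesis by simp
qed

section \<open>The iteration and its errors\<close>

text \<open>Moving \<open>xs\<close> along a kernel vector stays within the solutions, so the
  squared distance to \<open>x0\<close> is a quadratic in \<open>t\<close> with its minimum at 0,
  and its linear coefficient vanishes.\<close>

lemma min_dist_solution_orthogonal:
  fixes A :: "real mat"
  assumes A: "A \<in> carrier_mat m n" and x0: "x0 \<in> carrier_vec n"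
    and min: "is_arg_min (\<lambda>x. enorm (x - x0)) (\<lambda>x. x \<in> carrier_vec n \<and> A *\<^sub>v x = b) xs"
    and u: "u \<in> carrier_vec n" "A *\<^sub>v u = 0\<^sub>v m"
  shows "u \<bullet> (x0 - xs) = 0"
proof -
  have xs: "xs \<in> carrier_vec n" "A *\<^sub>v xs = b" using min by (auto simp: is_arg_min_def)
  define z where "z = xs - x0"
  have z: "z \<in> carrier_vec n" using xs x0 by (simp add: z_def)
  have "z \<bullet> u = 0"
  proof (rule nonneg_quadratic_linear_coeff_0)
    fix t :: real
    have "A *\<^sub>v (xs + t \<cdot>\<^sub>v u) = b + t \<cdot>\<^sub>v (0\<^sub>v m)"
      using mult_add_distrib_mat_vec[OF A xs(1)] mult_mat_vec[OF A u(1)] u xs by simp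
    also have "\<dots> = b" using xs(2) A by (intro eq_vecI) auto
    finally have "enorm z \<le> enorm (xs + t \<cdot>\<^sub>v u - x0)"
      using min u xs by (auto simp: is_arg_min_def z_def not_less)
    also have "xs + t \<cdot>\<^sub>v u - x0 = z + t \<cdot>\<^sub>v u"
      using xs u x0 by (intro eq_vecI) (auto simp: z_def)
    finally have "z \<bullet> z \<le> (z + t \<cdot>\<^sub>v u) \<bullet> (z + t \<cdot>\<^sub>v u)"
      by (simp add: enorm_def)
    then show "0 \<le> 2 * t * (z \<bullet> u) + t\<^sup>2 * (u \<bullet> u)"
      using z u comm_scalar_prod[OF z u(1)]
      by (simp add: add_scalar_prod_distrib[of _ n] scalar_prod_add_distrib[of _ n] power2_eq_square algebra_simps)
  qed
  moreover have "u \<bullet> (x0 - xs) = - (z \<bullet> u)"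
    using u x0 xs comm_scalar_prod[OF u(1) x0] comm_scalar_prod[OF u(1) xs(1)]
    by (simp add: z_def minus_scalar_prod_distrib[of _ n] scalar_prod_minus_distrib[of _ n])
  ultimately show ?thesis by simp
qed

lemma refl_iter_carrier:
  assumes "A \<in> carrier_mat m n" "x0 \<in> carrier_vec n"
  shows "refl_iter A b x0 k \<in> carrier_vec n"
  using assms by (induction k) (auto simp: Let_def)

text \<open>As \<open>b\<close> equals \<open>A xs\<close>, the residual is minus the scalar product
  of the row with the error, so the update reflects the error.\<close>

lemma refl_iter_error:
  assumes A: "A \<in> carrier_mat m n" and m: "0 < m" and x0: "x0 \<in> carrier_vec n"
    and xs: "xs \<in> carrier_vec n" "A *\<^sub>v xs = b"
  shows "refl_iter A b x0 (Suc k) - xs = reflection n (row A (k mod m)) *\<^sub>v (refl_iter A b x0 k - xs)"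
proof -
  let ?a = "row A (k mod m)" and ?x = "refl_iter A b x0 k"
  have a: "?a \<in> carrier_vec n" and x: "?x \<in> carrier_vec n"
    using A refl_iter_carrier[OF A x0] by auto
  have "b $ (k mod m) = ?a \<bullet> xs" using A m xs by auto
  moreover define s where "s = ?a \<bullet> (?x - xs)"
  ultimately have "b $ (k mod m) - ?a \<bullet> ?x = - s"
    using a x xs by (simp add: scalar_prod_minus_distrib[of _ n])
  then have "refl_iter A b x0 (Suc k) = ?x + (2 * (- s / (enorm ?a)\<^sup>2)) \<cdot>\<^sub>v ?a"
    using A by (simp only: refl_iter.simps Let_def carrier_matD)
  moreover have "reflection n ?a *\<^sub>v (?x - xs) = ?x - xs - (2 * s / (enorm ?a)\<^sup>2) \<cdot>\<^sub>v ?a"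
    using reflection_mult_vec[OF a, of "?x - xs"] x xs by (simp add: s_def)
  ultimately show ?thesis
    using carrier_vecD[OF a] carrier_vecD[OF x] xs
    by (intro eq_vecI) (simp_all del: refl_iter.simps)
qed

section \<open>Convergence of the averages and the choice of \<open>N\<close>\<close>

theorem theorem20:
  shows "\<exists>C>0::real. \<forall>(m::nat) (n::nat) (A::real mat) (b::real vec) (x0::real vec) (xs::real vec).
    0 < m \<longrightarrow>
    A \<in> carrier_mat m n \<longrightarrow>
    b \<in> carrier_vec m \<longrightarrow>
    (\<forall>i<m. row A i \<noteq> 0\<^sub>v n) \<longrightarrow>
    (\<exists>x\<in>carrier_vec n. A *\<^sub>v x = b) \<longrightarrow>
    reflection_consistent A \<longrightarrow>
    x0 \<in> carrier_vec n \<longrightarrow>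
    is_arg_min (\<lambda>x. enorm (x - x0)) (\<lambda>x. x \<in> carrier_vec n \<and> A *\<^sub>v x = b) xs \<longrightarrow>
    (\<lambda>N. enorm (average n (refl_iter A b x0) N - xs)) \<longlonglongrightarrow> 0 \<and>
    (\<forall>\<epsilon>::real. 0 < \<epsilon> \<and> \<epsilon> \<le> 1 \<longrightarrow>
      (\<exists>N::nat. 0 < N \<and> real N \<le> C * eigengap_inv A / \<epsilon> \<and>
        enorm (average n (\<lambda>i. refl_iter A b x0 (i * m)) N - xs) \<le> \<epsilon> * enorm (x0 - xs)))"
proof (rule exI[of _ 10], intro conjI allI impI)
  fix m n A b x0 xs
  assume m: "0 < m" and A: "A \<in> carrier_mat m n" and nz: "\<forall>i<m. row A i \<noteq> 0\<^sub>v n"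
    and rc: "reflection_consistent A" and x0: "x0 \<in> carrier_vec n"
    and min: "is_arg_min (\<lambda>x. enorm (x - x0)) (\<lambda>x. x \<in> carrier_vec n \<and> A *\<^sub>v x = b) xs"
  have xs: "xs \<in> carrier_vec n" "A *\<^sub>v xs = b" using min by (auto simp: is_arg_min_def)
  define y where "y k = refl_iter A b x0 k - xs" for k
  have xc: "refl_iter A b x0 k \<in> carrier_vec n" for k by (rule refl_iter_carrier[OF A x0])
  have y: "y (Suc k) = reflection n (row A (k mod m)) *\<^sub>v y k" for k
    unfolding y_def by (rule refl_iter_error[OF A m x0 xs])
  have y0: "y 0 = x0 - xs" "y 0 \<in> carrier_vec n" using x0 xs by (auto simp: y_def)
  have R: "refl_mat A \<in> carrier_mat n n" by (rule refl_mat_carrier[OF A])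
  have iso: "enorm (refl_mat A *\<^sub>v x) = enorm x" if "x \<in> carrier_vec n" for x
    using enorm_reflection_prod[of "rows A" n x] that A rows_carrier[of A] by (simp add: refl_mat_def)
  define W where "W = {x \<in> carrier_vec n. \<forall>u\<in>carrier_vec n. refl_mat A *\<^sub>v u = u \<longrightarrow> u \<bullet> x = 0}"
  have kernel: "A *\<^sub>v u = 0\<^sub>v m" if "u \<in> carrier_vec n" "refl_mat A *\<^sub>v u = u" for u
    using fixed_refl_mat_iff[OF A _ rc] nz that by blast
  have yW: "y 0 \<in> W"
    using min_dist_solution_orthogonal[OF A x0 min] kernel y0 by (auto simp: W_def)
  have r0: "row A 0 \<in> carrier_vec n" "row A 0 \<noteq> 0\<^sub>v n" using A m nz by auto
  \<comment> \<open>The first row is a nonzero element of \<open>W\<close> even when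
    \<open>y 0\<close> is zero, so it serves as the witness for the eigengap lemmas.\<close>
  have rW: "row A 0 \<in> W"
  proof -
    have "u \<bullet> row A 0 = 0" if "u \<in> carrier_vec n" "refl_mat A *\<^sub>v u = u" for u
      using arg_cong[OF kernel[OF that], of "\<lambda>v. v $ 0"] comm_scalar_prod[OF that(1) r0(1)] A m by simp
    then show ?thesis using r0 by (auto simp: W_def)
  qed
  let ?\<eta> = "eigengap_inv A"
  have eta: "1 / 4 \<le> ?\<eta>" by (rule eigengap_displacement(1)[OF R iso W_def rW r0(2)])
  have block: "enorm (vsum n (\<lambda>i. y (i * m)) N) \<le> 6 * ?\<eta> * enorm (y 0)" for N
    using enorm_orbit_sum_le[OF R iso W_def rW r0(2), of "\<lambda>i. y (i * m)" N] yW
      reflection_orbit(3)[OF A y0(2) y m] by simp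
  \<comment> \<open>Used with \<open>l = 1\<close> for the whole sequence and with
    \<open>l = m\<close> for the block starts.\<close>
  have ynorm: "enorm (average n (\<lambda>i. refl_iter A b x0 (i * l)) N - xs) \<le> K / real N"
    if "0 < N" "enorm (vsum n (\<lambda>i. y (i * l)) N) \<le> K" for l N K
  proof -
    have "vsum n (\<lambda>i. y (i * l)) N \<in> carrier_vec n" using xc xs by (simp add: y_def)
    then show ?thesis
      using average_minus[OF xc xs(1) that(1), of "\<lambda>i. i * l"] enorm_smult that
      by (simp add: y_def divide_right_mono)
  qed
  \<comment> \<open>This bound depends on \<open>m\<close> but not on \<open>N\<close>, so division
    by \<open>N\<close> sends it to zero.\<close>
  define K where "K = real m * (6 * ?\<eta> * enorm (y 0)) + real m * enorm (y 0)"
  have full: "enorm (vsum n y N) \<le> K" for N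
    unfolding K_def by (rule enorm_full_orbit_sum_le[OF A m y0(2) y block])
  show "(\<lambda>N. enorm (average n (refl_iter A b x0) N - xs)) \<longlonglongrightarrow> 0"
  proof (rule tendsto_sandwich[of "\<lambda>_. 0" _ _ "\<lambda>N. K / real N"])
    show "\<forall>\<^sub>F N in sequentially. enorm (average n (refl_iter A b x0) N - xs) \<le> K / real N"
      using eventually_gt_at_top[of 0]
      by eventually_elim (use ynorm[of _ 1 K] full in simp)
  qed (auto intro: lim_const_over_n)
  fix \<epsilon> :: real assume eps: "0 < \<epsilon> \<and> \<epsilon> \<le> 1"
  \<comment> \<open>Large enough for the block bound to give \<open>\<epsilon>\<close>. Rounding up
    costs at most 1, which is at most \<open>4 * ?\<eta> / \<epsilon>\<close> since
    \<open>?\<eta>\<close> is at least \<open>1 / 4\<close> and \<open>\<epsilon>\<close> at most 1;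
    hence the constant 10 = 6 + 4.\<close>
  define N where "N = nat \<lceil>6 * ?\<eta> / \<epsilon>\<rceil>"
  have pos: "0 < 6 * ?\<eta> / \<epsilon>" using eta eps by (intro divide_pos_pos) auto
  then have N: "6 * ?\<eta> / \<epsilon> \<le> real N" "real N \<le> 6 * ?\<eta> / \<epsilon> + 1"
    unfolding N_def by linarith+
  then have Npos: "0 < N" using pos by (intro gr0I) auto
  have "1 \<le> 4 * ?\<eta> / \<epsilon>" using eta eps by (simp add: field_simps)
  then have "real N \<le> 10 * ?\<eta> / \<epsilon>" using N(2) by (simp add: add_divide_distrib)
  moreover have "enorm (average n (\<lambda>i. refl_iter A b x0 (i * m)) N - xs) \<le> \<epsilon> * enorm (x0 - xs)"
  proof -
    have "6 * ?\<eta> / real N \<le> \<epsilon>" using N(1) Npos eps by (simp add: field_simps)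
    then have "6 * ?\<eta> / real N * enorm (y 0) \<le> \<epsilon> * enorm (y 0)" by (rule mult_right_mono) simp
    then show ?thesis using ynorm[OF Npos block] by (simp add: y0(1))
  qed
  ultimately show "\<exists>N::nat. 0 < N \<and> real N \<le> 10 * ?\<eta> / \<epsilon> \<and>
        enorm (average n (\<lambda>i. refl_iter A b x0 (i * m)) N - xs) \<le> \<epsilon> * enorm (x0 - xs)"
    using Npos by blast
qed simp

end
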